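(* Let $\alpha\in(0,1)$ and $$\lambda_{n,d,\alpha}=4\Big(\big(d\log(4n^2/\alpha)\big)^{1/4}\vee\big(8\log(4n^2/\alpha)\big)^{1/2}\Big).$$ Let $k\in[n]$, let $\hat\pi=\hat\pi_k^{\mathrm{LSS}}$ and let $\hat S$ be the support (domain) of $\hat\pi$. If $k\le k^*$ and $\bar\kappa_{\mathrm{all}}\ge\lambda_{n,d,\alpha}$, then, with probability at least $1-\alpha$, the support of $\hat\pi$ is included in $S^*$ and $\hat\pi$ coincides with $\pi^*$ on $\hat S$; that is, $$\mathbf P\big(\hat S\subset S^*\ \text{ and }\ \hat\pi(i)=\pi^*(i)\ \ \forall i\in\hat S\big)\ge 1-\alpha .$$
   Context: Notation: $[n]=\{1,\dots,n\}$, $a\vee b=\max(a,b)$. Model. Let $n\ge2$, $m=n$, $d\ge1$. One observes $X_i=\theta_i+\sigma\xi_i$ for $i\in[n]$ and $X^{\#}_j=\theta^{\#}_j+\sigma^{\#}\xi^{\#}_j$ for $j\in[m]$, where $\theta_i,\theta^{\#}_j\in\mathbb R^d$ are deterministic vectors, $\xi_1,\dots,\xi_n,\xi^{\#}_1,\dots,\xi^{\#}_m$ are i.i.d. $\mathcal N(0,\mathbf I_d)$, and $\sigma,\sigma^{\#}\ge 0$ with $\sigma^2+(\sigma^{\#})^2>0$. There are a set $S^*\subset[n]$ of cardinality $k^*$ and an injective map $\pi^*:S^*\to[m]$ such that $\theta_i=\theta^{\#}_{\pi^*(i)}$ for all $i\in S^*$. Signal-to-noise ratio: $\kappa_{i,j}=\|\theta_i-\theta^{\#}_j\|_2/(\sigma^2+(\sigma^{\#})^2)^{1/2}$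 and $\bar\kappa_{\mathrm{all}}=\min_{i\in[n]}\min_{j\in[m]\setminus\{\pi^*(i)\}}\kappa_{i,j}$, where for $i\notin S^*$ the set $\{\pi^*(i)\}$ is empty. Estimator. For $k\in[n]$, $\mathcal P_k$ is the set of all injective maps $\pi:S\to[m]$ with $S\subset[n]$, $|S|=k$; $S_\pi$ denotes the domain (support) of $\pi$. $\hat\pi_k^{\mathrm{LSS}}$ is any element of $\arg\min_{\pi\in\mathcal P_k}\sum_{i\in S_\pi}\|X_i-X^{\#}_{\pi(i)}\|_2^2$. *)

theory Defs
  imports "HOL-Probability.Probability"
begin

definition std_gaussian_vector :: "'w measure \<Rightarrow> ('w \<Rightarrow> real ^ 'd) \<Rightarrow> bool" where
  "std_gaussian_vector M Z \<longleftrightarrow>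
     distributed M lborel Z (\<lambda>x. ennreal (\<Prod>i\<in>UNIV. std_normal_density (x $ i)))"

text \<open>A map defined on a subset of \<open>{1..n}\<close> is encoded as a partial map
  \<open>nat \<rightharpoonup> nat\<close>, whose domain is the support.\<close>

definition matching_maps :: "nat \<Rightarrow> nat \<Rightarrow> nat \<Rightarrow> (nat \<rightharpoonup> nat) set" where
  "matching_maps n m k =
     {p. dom p \<subseteq> {1..n} \<and> card (dom p) = k \<and> ran p \<subseteq> {1..m} \<and> inj_on p (dom p)}"

definition is_LSS ::
  "nat \<Rightarrow> nat \<Rightarrow> nat \<Rightarrow> (nat \<Rightarrow> real ^ 'd) \<Rightarrow> (nat \<Rightarrow> real ^ 'd) \<Rightarrow> (nat \<rightharpoonup> nat) \<Rightarrow> bool" where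
  "is_LSS n m k x y p \<longleftrightarrow>
     is_arg_min (\<lambda>q. \<Sum>i\<in>dom q. (norm (x i - y (the (q i))))\<^sup>2) (\<lambda>q. q \<in> matching_maps n m k) p"

definition snr ::
  "real \<Rightarrow> real \<Rightarrow> (nat \<Rightarrow> real ^ 'd) \<Rightarrow> (nat \<Rightarrow> real ^ 'd) \<Rightarrow> nat \<Rightarrow> nat \<Rightarrow> real" where
  "snr s t \<theta> \<theta>' i j = norm (\<theta> i - \<theta>' j) / sqrt (s\<^sup>2 + t\<^sup>2)"

text \<open>For \<open>i\<close> outside the domain of \<open>p\<close> the removed set is empty. The minima are over nonempty sets
  as soon as \<open>n \<ge> 1\<close> and \<open>m \<ge> 2\<close>.\<close>

definition snr_all ::
  "nat \<Rightarrow> nat \<Rightarrow> real \<Rightarrow> real \<Rightarrow> (nat \<Rightarrow> real ^ 'd) \<Rightarrow> (nat \<Rightarrow> real ^ 'd) \<Rightarrow> (nat \<rightharpoonup> nat) \<Rightarrow> real" where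
  "snr_all n m s t \<theta> \<theta>' p =
     (MIN i\<in>{1..n}. MIN j\<in>{1..m} - {j. p i = Some j}. snr s t \<theta> \<theta>' i j)"

definition snr_threshold :: "nat \<Rightarrow> nat \<Rightarrow> real \<Rightarrow> real" where
  "snr_threshold n d \<alpha> =
     4 * max ((real d * ln (4 * (real n)\<^sup>2 / \<alpha>)) powr (1 / 4))
             ((8 * ln (4 * (real n)\<^sup>2 / \<alpha>)) powr (1 / 2))"

end

theory Submission
  imports Defs
begin

text \<open>
  The estimator minimises a sum of squared distances, so the theorem follows from one separation
  event: every pair \<open>(i, \<pi>\<^sup>*(i))\<close> costs less, and every other pair costs more, than a common cut
  \<open>u\<close>. On this event, if the minimiser contained a pair outside \<open>\<pi>\<^sup>*\<close>, one could discard all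
  such pairs and replace them by equally many unused pairs of \<open>\<pi>\<^sup>*\<close> (there are enough of them
  because \<open>k \<le> k\<^sup>*\<close>), keeping injectivity and strictly lowering the cost
  (\<open>separated_minimizer_is_submap\<close>).

  For the probability of the event write \<open>s = \<sigma>\<^sup>2 + \<sigma>'\<^sup>2\<close>, \<open>d\<close> for the dimension,
  \<open>t = log(4n\<^sup>2/\<alpha>)\<close> and \<open>K\<close> for the square of the threshold. The difference \<open>X\<^sub>i - X'\<^sub>j\<close> is a
  Gaussian vector with mean \<open>\<mu> = \<theta>\<^sub>i - \<theta>'\<^sub>j\<close> and covariance \<open>s I\<close>, so its squared norm is a scaled
  noncentral chi-square variable: for \<open>2as < 1\<close>,
  \<open>E exp(a \<parallel>X\<^sub>i - X'\<^sub>j\<parallel>\<^sup>2) = (1 - 2as)\<^bsup>-d/2\<^esup> exp(a \<parallel>\<mu>\<parallel>\<^sup>2/(1 - 2as))\<close>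
  (\<open>nn_integral_exp_norm_gaussian_diff\<close>). The cut is \<open>u = s(d + K/3)\<close>. Chernoff's bound is applied
  with \<open>a = b/s\<close> for \<open>\<pi>\<^sup>*\<close>-pairs (where \<open>\<mu> = 0\<close>) and with \<open>a = -b/s\<close> for the other pairs
  (where \<open>\<parallel>\<mu>\<parallel>\<^sup>2 \<ge> sK\<close>). In both cases the exponent is at most \<open>4b\<^sup>2d - bK/3\<close>. The
  choice \<open>b = 16t/K\<close> fits both regimes of the maximum in the threshold: \<open>K \<ge> 16 sqrt(dt)\<close> gives
  \<open>b\<^sup>2d \<le> t\<close>, and \<open>K \<ge> 128t\<close> gives \<open>b \<le> 1/8\<close>. The exponent is then at most
  \<open>4t - 16t/3 \<le> -t\<close>, so each of the \<open>n\<^sup>2\<close> pairs falls on the wrong side of the cut with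
  probability at most \<open>\<alpha>/(4n\<^sup>2)\<close>, and a union bound finishes the proof.
\<close>

section \<open>Exchange argument for separated costs\<close>

text \<open>The competitor \<open>q\<close> keeps the set \<open>A\<close> on which \<open>p\<close> agrees with \<open>r\<close> and completes it inside
  \<open>r\<close> to cardinality \<open>k\<close>. As a restriction of \<open>r\<close> it is injective without further care, and it
  trades \<open>k - |A|\<close> costs above \<open>u\<close> for as many below \<open>u\<close>.\<close>

lemma separated_minimizer_is_submap:
  fixes c :: "nat \<Rightarrow> nat \<Rightarrow> real"
  assumes min: "is_arg_min (\<lambda>q. \<Sum>i\<in>dom q. c i (the (q i))) (\<lambda>q. q \<in> matching_maps n m k) p"
    and r: "r \<in> matching_maps n m l" and "k \<le> l"
    and below: "\<And>i j. r i = Some j \<Longrightarrow> c i j < u"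
    and above: "\<And>i j. i \<in> {1..n} \<Longrightarrow> j \<in> {1..m} \<Longrightarrow> r i \<noteq> Some j \<Longrightarrow> u < c i j"
  shows "p \<subseteq>\<^sub>m r"
proof (rule ccontr)
  assume not_sub: "\<not> p \<subseteq>\<^sub>m r"
  define A where "A = {i \<in> dom p. p i = r i}"
  have p: "dom p \<subseteq> {1..n}" "card (dom p) = k" "ran p \<subseteq> {1..m}"
    using min by (auto simp: is_arg_min_def matching_maps_def)
  have r': "dom r \<subseteq> {1..n}" "card (dom r) = l" "ran r \<subseteq> {1..m}" "inj_on r (dom r)"
    using r by (auto simp: matching_maps_def)
  have fin: "finite (dom p)" "finite (dom r)"
    using p(1) r'(1) by (auto intro: finite_subset)
  have A: "A \<subseteq> dom p" "A \<subseteq> dom r"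
    by (auto simp: A_def) (metis domI)
  have "card A \<le> k"
    using card_mono[OF fin(1) A(1)] p(2) by simp
  then obtain T where T: "A \<subseteq> T" "T \<subseteq> dom r" "card T = k"
    using exists_subset_between[of A k "dom r"] A(2) fin(2) r'(2) \<open>k \<le> l\<close> by auto
  have finT: "finite T" and finA: "finite A"
    using T fin by (auto intro: finite_subset)
  define q where "q = r |` T"
  have dom_q: "dom q = T"
    using T(2) by (auto simp: q_def)
  have "inj_on q T"
    using inj_on_subset[OF r'(4) T(2)] by (simp add: q_def inj_on_def)
  then have q: "q \<in> matching_maps n m k"
    using T r'(1,3) unfolding matching_maps_def mem_Collect_eq dom_q
    by (auto simp: q_def ran_def restrict_map_def split: if_splits)
  have card_eq: "card (T - A) = card (dom p - A)"
    using T(1,3) A(1) p(2) finA by (simp add: card_Diff_subset)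
  have ne: "dom p - A \<noteq> {}"
    using not_sub by (auto simp: A_def map_le_def)
  then have "card (T - A) > 0"
    unfolding card_eq using fin(1) by (simp add: card_gt_0_iff)
  then have neT: "T - A \<noteq> {}"
    by force
  have "(\<Sum>i\<in>T. c i (the (q i))) = (\<Sum>i\<in>T - A. c i (the (q i))) + (\<Sum>i\<in>A. c i (the (q i)))"
    using sum.subset_diff[OF T(1) finT] .
  also have "(\<Sum>i\<in>A. c i (the (q i))) = (\<Sum>i\<in>A. c i (the (p i)))"
    using T(1) by (intro sum.cong) (auto simp: q_def A_def)
  also have "(\<Sum>i\<in>T - A. c i (the (q i))) < (\<Sum>i\<in>T - A. u)"
    using finT neT T(2) by (intro sum_strict_mono) (auto simp: q_def intro!: below)
  also have "(\<Sum>i\<in>T - A. u) = (\<Sum>i\<in>dom p - A. u)"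
    using card_eq by simp
  also have "\<dots> \<le> (\<Sum>i\<in>dom p - A. c i (the (p i)))"
  proof (rule sum_mono)
    fix i assume i: "i \<in> dom p - A"
    then obtain j where j: "p i = Some j" "i \<in> dom p" "p i \<noteq> r i"
      by (auto simp: A_def)
    then have "u < c i j"
      using p by (intro above) (auto simp: ran_def)
    then show "u \<le> c i (the (p i))"
      using j by simp
  qed
  also have "(\<Sum>i\<in>dom p - A. c i (the (p i))) + (\<Sum>i\<in>A. c i (the (p i)))
      = (\<Sum>i\<in>dom p. c i (the (p i)))"
    by (rule sum.subset_diff[OF A(1) fin(1), symmetric])
  finally have "(\<Sum>i\<in>dom q. c i (the (q i))) < (\<Sum>i\<in>dom p. c i (the (p i)))"
    by (simp add: dom_q)
  then show False
    using min q by (auto simp: is_arg_min_def)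
qed

section \<open>Exponential moments of squared Gaussian norms\<close>

text \<open>Completing the square turns the integrand into a multiple of a normal density. The affine
  argument \<open>c + s x\<close> gives the formula a shape that is stable under iteration, which is how two
  independent noises are combined below.\<close>

lemma nn_integral_exp_square_normal:
  fixes a c s :: real
  assumes "2 * a * s\<^sup>2 < 1"
  shows "(\<integral>\<^sup>+x. ennreal (std_normal_density x * exp (a * (c + s * x)\<^sup>2)) \<partial>lborel)
    = ennreal (exp (a * c\<^sup>2 / (1 - 2 * a * s\<^sup>2)) / sqrt (1 - 2 * a * s\<^sup>2))"
proof -
  define v where "v = 1 - 2 * a * s\<^sup>2"
  have v: "v > 0"
    using assms by (simp add: v_def)
  define m where "m = 2 * a * s * c / v"
  define C where "C = exp (a * c\<^sup>2 / v) / sqrt v"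
  have exponent: "a * (c + s * x)\<^sup>2 - x\<^sup>2 / 2 = a * c\<^sup>2 / v - v * (x - m)\<^sup>2 / 2" for x
  proof -
    have "v * (a * c\<^sup>2 / v - v * (x - m)\<^sup>2 / 2) = a * c\<^sup>2 - (v * x - v * m)\<^sup>2 / 2"
      using v by (simp add: field_simps power2_eq_square)
    also have "v * m = 2 * a * s * c"
      using v by (simp add: m_def)
    also have "a * c\<^sup>2 - (v * x - 2 * a * s * c)\<^sup>2 / 2 = v * (a * (c + s * x)\<^sup>2 - x\<^sup>2 / 2)"
      unfolding v_def by (simp add: field_simps power2_eq_square)
    finally show ?thesis
      using v by simp
  qed
  have density: "std_normal_density x * exp (a * (c + s * x)\<^sup>2)
      = C * normal_density m (1 / sqrt v) x" for x
  proof -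
    have "std_normal_density x * exp (a * (c + s * x)\<^sup>2)
        = exp (a * (c + s * x)\<^sup>2 - x\<^sup>2 / 2) / sqrt (2 * pi)"
      by (simp add: std_normal_density_def exp_diff exp_minus inverse_eq_divide mult.commute)
    also have "\<dots> = exp (a * c\<^sup>2 / v) * exp (- (v * (x - m)\<^sup>2 / 2)) / sqrt (2 * pi)"
      unfolding exponent by (simp flip: exp_add)
    also have "\<dots> = C * normal_density m (1 / sqrt v) x"
      using v by (simp add: C_def normal_density_def power_divide real_sqrt_divide mult.commute)
    finally show ?thesis .
  qed
  have "(\<integral>\<^sup>+x. ennreal (normal_density m (1 / sqrt v) x) \<partial>lborel) = 1"
    using v by (subst nn_integral_eq_integral) (auto simp: normal_density_nonneg)
  moreover have "C \<ge> 0"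
    using v by (simp add: C_def)
  ultimately have "(\<integral>\<^sup>+x. ennreal (C * normal_density m (1 / sqrt v) x) \<partial>lborel) = ennreal C"
    by (simp add: ennreal_mult' nn_integral_cmult)
  then show ?thesis
    unfolding density by (simp add: C_def v_def)
qed

lemma bij_betw_axis_Basis: "bij_betw (\<lambda>i. axis i 1 :: real ^ 'd) UNIV Basis"
  by (auto simp: bij_betw_def inj_on_def Basis_vec_def axis_eq_axis)

lemma prod_components_eq_prod_Basis:
  fixes x :: "real ^ 'd"
  shows "(\<Prod>i\<in>UNIV. f (x $ i)) = (\<Prod>b\<in>Basis. f (x \<bullet> b))"
  using prod.reindex_bij_betw[OF bij_betw_axis_Basis, of "\<lambda>b. f (x \<bullet> b)"]
  by (simp add: cart_eq_inner_axis)

lemma exp_square_norm_eq_prod: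
  fixes z :: "'a :: euclidean_space"
  shows "exp (a * (norm z)\<^sup>2) = (\<Prod>b\<in>Basis. exp (a * (z \<bullet> b)\<^sup>2))"
proof -
  have "(norm z)\<^sup>2 = (\<Sum>b\<in>Basis. (z \<bullet> b)\<^sup>2)"
    unfolding power2_norm_eq_inner by (subst euclidean_inner) (simp add: power2_eq_square)
  then show ?thesis
    by (simp add: sum_distrib_left exp_sum)
qed

lemma nn_integral_exp_norm_std_gaussian:
  fixes Z :: "'w \<Rightarrow> real ^ 'd" and c :: "real ^ 'd"
  assumes Z: "std_gaussian_vector M Z" and as: "2 * a * s\<^sup>2 < 1"
  shows "(\<integral>\<^sup>+\<omega>. ennreal (exp (a * (norm (c + s *\<^sub>R Z \<omega>))\<^sup>2)) \<partial>M)
    = ennreal (exp (a * (norm c)\<^sup>2 / (1 - 2 * a * s\<^sup>2)) / sqrt (1 - 2 * a * s\<^sup>2) ^ CARD('d))"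
proof -
  let ?v = "1 - 2 * a * s\<^sup>2"
  have "(\<integral>\<^sup>+\<omega>. ennreal (exp (a * (norm (c + s *\<^sub>R Z \<omega>))\<^sup>2)) \<partial>M)
    = (\<integral>\<^sup>+x. ennreal (\<Prod>i\<in>UNIV. std_normal_density (x $ i)) *
         ennreal (exp (a * (norm (c + s *\<^sub>R x))\<^sup>2)) \<partial>lborel)"
    using Z unfolding std_gaussian_vector_def
    by (subst distributed_nn_integral[symmetric,
          where g = "\<lambda>x. ennreal (exp (a * (norm (c + s *\<^sub>R x))\<^sup>2))"]) auto
  also have "\<dots> = (\<integral>\<^sup>+x. (\<Prod>b\<in>Basis. ennreal (std_normal_density (x \<bullet> b) *
         exp (a * (c \<bullet> b + s * (x \<bullet> b))\<^sup>2))) \<partial>lborel)"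
    by (intro nn_integral_cong, subst ennreal_mult'[symmetric])
       (auto simp: prod_nonneg prod_components_eq_prod_Basis exp_square_norm_eq_prod prod_ennreal
          inner_add_left prod.distrib[symmetric])
  also have "\<dots> = (\<Prod>b\<in>(Basis :: (real ^ 'd) set). \<integral>\<^sup>+x. ennreal (std_normal_density x *
         exp (a * (c \<bullet> b + s * x)\<^sup>2)) \<partial>lborel)"
    by (rule nn_integral_lborel_prod[where f = "\<lambda>b x. ennreal (std_normal_density x *
         exp (a * (c \<bullet> b + s * x)\<^sup>2))"]) auto
  also have "\<dots> = (\<Prod>b\<in>(Basis :: (real ^ 'd) set).
      ennreal (exp (a * (c \<bullet> b)\<^sup>2 / ?v) / sqrt ?v))"
    by (simp add: nn_integral_exp_square_normal[OF as])
  also have "\<dots> = ennreal (\<Prod>b\<in>(Basis :: (real ^ 'd) set). exp (a / ?v * (c \<bullet> b)\<^sup>2) / sqrt ?v)"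
    using as by (subst prod_ennreal) auto
  also have "\<dots> = ennreal (exp (a / ?v * (norm c)\<^sup>2) / sqrt ?v ^ CARD('d))"
    by (simp only: prod_dividef exp_square_norm_eq_prod prod_constant DIM_cart DIM_real mult_1_right)
  finally show ?thesis
    by simp
qed

lemma (in prob_space) indep_var_of_indep_vars:
  assumes ind: "indep_vars N X I" and ij: "i \<in> I" "j \<in> I" "i \<noteq> j"
  shows "indep_var (N i) (X i) (N j) (X j)"
proof -
  have "indep_var (PiM {i} N) (\<lambda>\<omega>. restrict (\<lambda>i. X i \<omega>) {i}) (PiM {j} N) (\<lambda>\<omega>. restrict (\<lambda>i. X i \<omega>) {j})"
    using ij by (intro indep_var_restrict[OF ind]) auto
  from indep_var_compose[OF this measurable_component_singleton measurable_component_singleton,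
      of i j]
  show ?thesis
    by (simp add: o_def)
qed

lemma (in prob_space) nn_integral_indep_var:
  assumes ind: "indep_var S X T Y" and f: "f \<in> borel_measurable (S \<Otimes>\<^sub>M T)"
  shows "(\<integral>\<^sup>+\<omega>. f (X \<omega>, Y \<omega>) \<partial>M) = (\<integral>\<^sup>+\<omega>. \<integral>\<^sup>+\<omega>'. f (X \<omega>, Y \<omega>') \<partial>M \<partial>M)"
proof -
  have rv[measurable]: "X \<in> measurable M S" "Y \<in> measurable M T"
    and joint: "distr M S X \<Otimes>\<^sub>M distr M T Y = distr M (S \<Otimes>\<^sub>M T) (\<lambda>x. (X x, Y x))"
    using ind by (auto simp: indep_var_distribution_eq)
  note f[measurable]
  interpret Y: prob_space "distr M T Y"
    by (rule prob_space_distr) simp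
  have "(\<integral>\<^sup>+\<omega>. f (X \<omega>, Y \<omega>) \<partial>M) = integral\<^sup>N (distr M (S \<Otimes>\<^sub>M T) (\<lambda>x. (X x, Y x))) f"
    by (subst nn_integral_distr) auto
  also have "\<dots> = (\<integral>\<^sup>+x. \<integral>\<^sup>+y. f (x, y) \<partial>distr M T Y \<partial>distr M S X)"
    unfolding joint[symmetric] by (rule Y.nn_integral_fst[symmetric]) simp
  also have "\<dots> = (\<integral>\<^sup>+\<omega>. \<integral>\<^sup>+y. f (X \<omega>, y) \<partial>distr M T Y \<partial>M)"
    by (subst nn_integral_distr) (auto intro!: Y.borel_measurable_nn_integral_fst)
  also have "\<dots> = (\<integral>\<^sup>+\<omega>. \<integral>\<^sup>+\<omega>'. f (X \<omega>, Y \<omega>') \<partial>M \<partial>M)"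
    by (intro nn_integral_cong, subst nn_integral_distr) auto
  finally show ?thesis .
qed

text \<open>Integrating out \<open>W\<close> replaces \<open>a\<close> by \<open>a/(1 - 2at\<^sup>2)\<close> and leaves an integral of the same form
  over \<open>Z\<close>. No degenerate case arises when \<open>s\<close> or \<open>t\<close> vanishes.\<close>

lemma (in prob_space) nn_integral_exp_norm_gaussian_diff:
  fixes Z W :: "'a \<Rightarrow> real ^ 'd"
  assumes Z: "std_gaussian_vector M Z" and W: "std_gaussian_vector M W"
    and ind: "indep_var borel Z borel W" and a: "2 * a * (s\<^sup>2 + t\<^sup>2) < 1"
  shows "(\<integral>\<^sup>+\<omega>. ennreal (exp (a * (norm (\<mu> + s *\<^sub>R Z \<omega> - t *\<^sub>R W \<omega>))\<^sup>2)) \<partial>M)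
    = ennreal (exp (a * (norm \<mu>)\<^sup>2 / (1 - 2 * a * (s\<^sup>2 + t\<^sup>2))) /
        sqrt (1 - 2 * a * (s\<^sup>2 + t\<^sup>2)) ^ CARD('d))"
proof -
  have at: "2 * a * t\<^sup>2 < 1"
  proof (cases "a \<ge> 0")
    case True
    then have "2 * a * t\<^sup>2 \<le> 2 * a * (s\<^sup>2 + t\<^sup>2)"
      by (intro mult_left_mono) auto
    with a show ?thesis by simp
  next
    case False
    then have "2 * a * t\<^sup>2 \<le> 0"
      by (simp add: mult_nonpos_nonneg)
    then show ?thesis by simp
  qed
  define v where "v = 1 - 2 * a * t\<^sup>2"
  define a' where "a' = a / v"
  have v: "v > 0"
    using at by (simp add: v_def)
  have split: "v * (1 - 2 * a' * s\<^sup>2) = 1 - 2 * a * (s\<^sup>2 + t\<^sup>2)"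
    using v by (simp add: a'_def v_def field_simps)
  have "0 < v * (1 - 2 * a' * s\<^sup>2)"
    using a unfolding split by simp
  then have a's: "2 * a' * s\<^sup>2 < 1"
    using v by (simp add: zero_less_mult_iff)
  have "(\<integral>\<^sup>+\<omega>. ennreal (exp (a * (norm (\<mu> + s *\<^sub>R Z \<omega> - t *\<^sub>R W \<omega>))\<^sup>2)) \<partial>M)
    = (\<integral>\<^sup>+\<omega>. \<integral>\<^sup>+\<omega>'. ennreal (exp (a * (norm ((\<mu> + s *\<^sub>R Z \<omega>) + (- t) *\<^sub>R W \<omega>'))\<^sup>2)) \<partial>M \<partial>M)"
    by (subst nn_integral_indep_var[OF ind,
          of "\<lambda>(z, w). ennreal (exp (a * (norm (\<mu> + s *\<^sub>R z - t *\<^sub>R w))\<^sup>2))", simplified]) auto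
  also have "\<dots> = (\<integral>\<^sup>+\<omega>. ennreal (1 / sqrt v ^ CARD('d)) *
      ennreal (exp (a' * (norm (\<mu> + s *\<^sub>R Z \<omega>))\<^sup>2)) \<partial>M)"
    using v at
    by (subst nn_integral_exp_norm_std_gaussian[OF W])
       (auto simp: v_def a'_def ennreal_mult'[symmetric])
  also have "\<dots> = ennreal (1 / sqrt v ^ CARD('d)) *
      (\<integral>\<^sup>+\<omega>. ennreal (exp (a' * (norm (\<mu> + s *\<^sub>R Z \<omega>))\<^sup>2)) \<partial>M)"
  proof (rule nn_integral_cmult)
    have [measurable]: "Z \<in> borel_measurable M"
      using ind by (simp add: indep_var_distribution_eq)
    show "(\<lambda>\<omega>. ennreal (exp (a' * (norm (\<mu> + s *\<^sub>R Z \<omega>))\<^sup>2))) \<in> borel_measurable M"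
      by measurable
  qed
  also have "\<dots> = ennreal (1 / sqrt v ^ CARD('d) * (exp (a' * (norm \<mu>)\<^sup>2 / (1 - 2 * a' * s\<^sup>2)) /
      sqrt (1 - 2 * a' * s\<^sup>2) ^ CARD('d)))"
    unfolding nn_integral_exp_norm_std_gaussian[OF Z a's]
    using v by (intro ennreal_mult'[symmetric]) simp
  also have "1 / sqrt v ^ CARD('d) * (exp (a' * (norm \<mu>)\<^sup>2 / (1 - 2 * a' * s\<^sup>2)) /
      sqrt (1 - 2 * a' * s\<^sup>2) ^ CARD('d))
    = exp (a * (norm \<mu>)\<^sup>2 / (v * (1 - 2 * a' * s\<^sup>2))) /
      sqrt (v * (1 - 2 * a' * s\<^sup>2)) ^ CARD('d)"
    by (simp add: a'_def real_sqrt_mult power_mult_distrib)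
  finally show ?thesis
    unfolding split .
qed

section \<open>Tail bounds at the common cut\<close>

lemma (in prob_space) Chernoff_from_nn_integral:
  assumes [measurable]: "Y \<in> borel_measurable M"
    and le: "(\<integral>\<^sup>+\<omega>. ennreal (exp (Y \<omega>)) \<partial>M) \<le> ennreal C" and "C \<ge> 0"
  shows "prob {\<omega> \<in> space M. u \<le> Y \<omega>} \<le> C * exp (- u)"
proof -
  have "{\<omega> \<in> space M. u \<le> Y \<omega>} = {\<omega> \<in> space M. 1 \<le> ennreal (exp (- u)) * ennreal (exp (Y \<omega>))}"
    by (auto simp: ennreal_mult'[symmetric] exp_add[symmetric])
  then have "emeasure M {\<omega> \<in> space M. u \<le> Y \<omega>}
      \<le> ennreal (exp (- u)) * (\<integral>\<^sup>+\<omega>. ennreal (exp (Y \<omega>)) * indicator (space M) \<omega> \<partial>M)"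
    using nn_integral_Markov_inequality[of "\<lambda>\<omega>. ennreal (exp (Y \<omega>))" "space M" M "ennreal (exp (- u))"]
    by simp
  also have "(\<integral>\<^sup>+\<omega>. ennreal (exp (Y \<omega>)) * indicator (space M) \<omega> \<partial>M)
      = (\<integral>\<^sup>+\<omega>. ennreal (exp (Y \<omega>)) \<partial>M)"
    by (intro nn_integral_cong) simp
  also have "ennreal (exp (- u)) * \<dots> \<le> ennreal (exp (- u)) * ennreal C"
    by (intro mult_left_mono le) simp
  finally have "ennreal (prob {\<omega> \<in> space M. u \<le> Y \<omega>}) \<le> ennreal (C * exp (- u))"
    using \<open>C \<ge> 0\<close> by (simp add: emeasure_eq_measure ennreal_mult'[symmetric] mult.commute)
  then show ?thesis
    using \<open>C \<ge> 0\<close> by (simp add: ennreal_le_iff)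
qed

text \<open>The term \<open>d b\<close> of the exponent cancels against the mean \<open>d\<close> of the chi-square variable in
  the Chernoff bounds, so that only the quadratic correction \<open>4 d b\<^sup>2\<close> is lost.\<close>

lemma inverse_sqrt_power_le_exp:
  fixes b :: real
  assumes "\<bar>b\<bar> \<le> 1 / 4"
  shows "1 / sqrt (1 - 2 * b) ^ d \<le> exp (real d * (b + 4 * b\<^sup>2))"
proof -
  have pos: "1 - 2 * b > 0"
    using assms by linarith
  have "\<bar>ln (1 + (- 2 * b)) - (- 2 * b)\<bar> \<le> 2 * (- 2 * b)\<^sup>2"
    using assms by (intro abs_ln_one_plus_x_minus_x_bound) auto
  then have "- ln (1 - 2 * b) / 2 \<le> b + 4 * b\<^sup>2"
    by (simp add: power_mult_distrib abs_le_iff)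
  moreover have "1 / sqrt (1 - 2 * b) = exp (- ln (1 - 2 * b) / 2)"
  proof -
    have "exp (ln (sqrt (1 - 2 * b))) = sqrt (1 - 2 * b)"
      using pos by simp
    then show ?thesis
      using pos by (simp add: ln_sqrt exp_minus inverse_eq_divide)
  qed
  ultimately have "1 / sqrt (1 - 2 * b) \<le> exp (b + 4 * b\<^sup>2)"
    by simp
  then have "(1 / sqrt (1 - 2 * b)) ^ d \<le> exp (b + 4 * b\<^sup>2) ^ d"
    using pos by (intro power_mono) auto
  then show ?thesis
    by (simp add: power_one_over exp_of_nat_mult)
qed

text \<open>Chernoff's bound for both tails at once: a positive \<open>b\<close> controls large values of the squared
  norm and a negative one small values.\<close>

lemma (in prob_space) gaussian_diff_tail:
  fixes Z W :: "'a \<Rightarrow> real ^ 'd"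
  assumes Z: "std_gaussian_vector M Z" and W: "std_gaussian_vector M W"
    and ind: "indep_var borel Z borel W" and v: "v = s\<^sup>2 + t\<^sup>2" "v > 0" and b: "\<bar>b\<bar> \<le> 1 / 4"
  shows "prob {\<omega> \<in> space M. b * u \<le> b * ((norm (\<mu> + s *\<^sub>R Z \<omega> - t *\<^sub>R W \<omega>))\<^sup>2 / v)}
    \<le> exp (real CARD('d) * (b + 4 * b\<^sup>2) + b / (1 - 2 * b) * ((norm \<mu>)\<^sup>2 / v) - b * u)"
proof -
  have [measurable]: "Z \<in> borel_measurable M" "W \<in> borel_measurable M"
    using ind by (simp_all add: indep_var_distribution_eq)
  have bv: "2 * (b / v) * (s\<^sup>2 + t\<^sup>2) = 2 * b"
    using v(2) unfolding v(1)[symmetric] by simp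
  let ?C = "exp (b / v * (norm \<mu>)\<^sup>2 / (1 - 2 * b)) / sqrt (1 - 2 * b) ^ CARD('d)"
  have "(\<integral>\<^sup>+\<omega>. ennreal (exp (b / v * (norm (\<mu> + s *\<^sub>R Z \<omega> - t *\<^sub>R W \<omega>))\<^sup>2)) \<partial>M) = ennreal ?C"
    using nn_integral_exp_norm_gaussian_diff[OF Z W ind, of "b / v" s t \<mu>] b unfolding bv by simp
  then have "prob {\<omega> \<in> space M. b * u \<le> b / v * (norm (\<mu> + s *\<^sub>R Z \<omega> - t *\<^sub>R W \<omega>))\<^sup>2}
      \<le> ?C * exp (- (b * u))"
    using b by (intro Chernoff_from_nn_integral) auto
  also have "?C = exp (b / v * (norm \<mu>)\<^sup>2 / (1 - 2 * b)) * (1 / sqrt (1 - 2 * b) ^ CARD('d))"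
    by simp
  also have "\<dots> * exp (- (b * u)) \<le> exp (b / v * (norm \<mu>)\<^sup>2 / (1 - 2 * b)) *
      exp (real CARD('d) * (b + 4 * b\<^sup>2)) * exp (- (b * u))"
    by (intro mult_right_mono mult_left_mono inverse_sqrt_power_le_exp b) auto
  also have "\<dots> = exp (real CARD('d) * (b + 4 * b\<^sup>2) + b / (1 - 2 * b) * ((norm \<mu>)\<^sup>2 / v) - b * u)"
    by (simp add: exp_add exp_diff exp_minus field_simps)
  finally show ?thesis
    by (simp add: times_divide_eq_left)
qed

text \<open>The two lower bounds on \<open>K\<close> come from the two terms of the maximum in the threshold. The tilt
  \<open>b = 16 t / K\<close> makes the gain \<open>b K / 3\<close> a fixed multiple of \<open>t\<close>.\<close>

lemma chernoff_tilt:
  fixes d K t :: real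
  assumes "t > 0" and K1: "K \<ge> 128 * t" and K2: "K\<^sup>2 \<ge> 256 * d * t"
  defines "b \<equiv> 16 * t / K"
  shows "0 < b" "b \<le> 1 / 8" "4 * d * b\<^sup>2 - b * K / 3 \<le> - t"
proof -
  have K: "K > 0"
    using assms by linarith
  show "0 < b" "b \<le> 1 / 8"
    using K K1 \<open>t > 0\<close> by (auto simp: b_def field_simps)
  have "d * b\<^sup>2 = 256 * d * t * t / K\<^sup>2"
    by (simp add: b_def power_divide power2_eq_square)
  also have "\<dots> \<le> K\<^sup>2 * t / K\<^sup>2"
    using K2 \<open>t > 0\<close> by (intro divide_right_mono mult_right_mono) auto
  finally have "d * b\<^sup>2 \<le> t"
    using K by simp
  moreover have "b * K = 16 * t"
    using K by (simp add: b_def)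
  ultimately show "4 * d * b\<^sup>2 - b * K / 3 \<le> - t"
    using \<open>t > 0\<close> by simp
qed

lemma (in prob_space) gaussian_diff_upper_tail:
  fixes Z W :: "'a \<Rightarrow> real ^ 'd"
  assumes "std_gaussian_vector M Z" "std_gaussian_vector M W" "indep_var borel Z borel W"
    and v: "v = s\<^sup>2 + t\<^sup>2" "v > 0"
    and L: "L > 0" "K \<ge> 128 * L" "K\<^sup>2 \<ge> 256 * real CARD('d) * L"
  shows "prob {\<omega> \<in> space M.
      real CARD('d) + K / 3 \<le> (norm (s *\<^sub>R Z \<omega> - t *\<^sub>R W \<omega>))\<^sup>2 / v} \<le> exp (- L)"
proof -
  define b where "b = 16 * L / K"
  note b = chernoff_tilt[OF L, folded b_def]
  have "prob {\<omega> \<in> space M. b * (real CARD('d) + K / 3) \<le>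
        b * ((norm (s *\<^sub>R Z \<omega> - t *\<^sub>R W \<omega>))\<^sup>2 / v)}
      \<le> exp (real CARD('d) * (b + 4 * b\<^sup>2) + b / (1 - 2 * b) * ((norm (0 :: real ^ 'd))\<^sup>2 / v)
          - b * (real CARD('d) + K / 3))"
    using gaussian_diff_tail[OF assms(1-5), of b "real CARD('d) + K / 3" 0] b by simp
  also have "\<dots> \<le> exp (- L)"
    using b(3) by (simp add: algebra_simps)
  finally show ?thesis
    unfolding mult_le_cancel_left_pos[OF b(1)] .
qed

lemma (in prob_space) gaussian_diff_lower_tail:
  fixes Z W :: "'a \<Rightarrow> real ^ 'd"
  assumes "std_gaussian_vector M Z" "std_gaussian_vector M W" "indep_var borel Z borel W"
    and v: "v = s\<^sup>2 + t\<^sup>2" "v > 0"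
    and L: "L > 0" "K \<ge> 128 * L" "K\<^sup>2 \<ge> 256 * real CARD('d) * L"
    and \<mu>: "K \<le> (norm \<mu>)\<^sup>2 / v"
  shows "prob {\<omega> \<in> space M.
      (norm (\<mu> + s *\<^sub>R Z \<omega> - t *\<^sub>R W \<omega>))\<^sup>2 / v \<le> real CARD('d) + K / 3} \<le> exp (- L)"
proof -
  define b where "b = 16 * L / K"
  note b = chernoff_tilt[OF L, folded b_def]
  have "K \<ge> 0"
    using L by linarith
  \<comment> \<open>Since \<open>b \<le> 1/8\<close>, the loss factor \<open>1/(1 + 2b)\<close> on the mean is at least \<open>4/5 > 2/3\<close>.\<close>
  have "2 / 3 * b \<le> b / (1 + 2 * b)"
    using b by (simp add: field_simps)
  then have "2 / 3 * b * K \<le> b / (1 + 2 * b) * ((norm \<mu>)\<^sup>2 / v)"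
    using b(1) \<mu> \<open>K \<ge> 0\<close> by (intro mult_mono) auto
  then have mean: "- b / (1 - 2 * - b) * ((norm \<mu>)\<^sup>2 / v) \<le> - (2 / 3 * b * K)"
    by simp
  have "prob {\<omega> \<in> space M. - b * (real CARD('d) + K / 3) \<le>
        - b * ((norm (\<mu> + s *\<^sub>R Z \<omega> - t *\<^sub>R W \<omega>))\<^sup>2 / v)}
      \<le> exp (real CARD('d) * (- b + 4 * (- b)\<^sup>2) + - b / (1 - 2 * - b) * ((norm \<mu>)\<^sup>2 / v)
          - - b * (real CARD('d) + K / 3))"
    using b by (intro gaussian_diff_tail assms) auto
  also have "\<dots> \<le> exp (- L)"
  proof -
    have "real CARD('d) * (- b + 4 * (- b)\<^sup>2) + e - - b * (real CARD('d) + K / 3) \<le> - L"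
      if "e \<le> - (2 / 3 * b * K)" for e
      using b(3) that by (simp add: algebra_simps)
    from this[OF mean] show ?thesis
      by simp
  qed
  finally show ?thesis
    unfolding mult_minus_left neg_le_iff_le mult_le_cancel_left_pos[OF b(1)] .
qed

section \<open>Recovery of the matching\<close>

lemma snr_threshold_bounds:
  fixes \<alpha> :: real
  assumes L: "L = ln (4 * (real n)\<^sup>2 / \<alpha>)" "L > 0"
  shows "0 \<le> snr_threshold n d \<alpha>" "128 * L \<le> (snr_threshold n d \<alpha>)\<^sup>2"
    "256 * real d * L \<le> ((snr_threshold n d \<alpha>)\<^sup>2)\<^sup>2"
proof -
  let ?x = "(real d * L) powr (1 / 4)" and ?y = "(8 * L) powr (1 / 2)"
  have thr: "snr_threshold n d \<alpha> = 4 * max ?x ?y"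
    by (simp add: snr_threshold_def L(1))
  show "0 \<le> snr_threshold n d \<alpha>"
    by (simp add: thr le_max_iff_disj)
  have "128 * L = (4 * ?y)\<^sup>2"
    using L(2) by (simp add: power_mult_distrib powr_half_sqrt)
  also have "\<dots> \<le> (snr_threshold n d \<alpha>)\<^sup>2"
    unfolding thr by (intro power_mono) auto
  finally show "128 * L \<le> (snr_threshold n d \<alpha>)\<^sup>2" .
  have "?x ^ 4 = real d * L"
    using L(2) by (cases "d = 0") (simp_all add: powr_power)
  then have "256 * real d * L = (4 * ?x) ^ 4"
    by (simp add: power_mult_distrib)
  also have "\<dots> \<le> (snr_threshold n d \<alpha>) ^ 4"
    unfolding thr by (intro power_mono) auto
  finally show "256 * real d * L \<le> ((snr_threshold n d \<alpha>)\<^sup>2)\<^sup>2"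
    by simp
qed

lemma snr_all_le_snr:
  assumes "i \<in> {1..n}" "j \<in> {1..m}" "p i \<noteq> Some j"
  shows "snr_all n m s t \<theta> \<theta>' p \<le> snr s t \<theta> \<theta>' i j"
proof -
  have "snr_all n m s t \<theta> \<theta>' p \<le> (MIN j\<in>{1..m} - {j. p i = Some j}. snr s t \<theta> \<theta>' i j)"
    unfolding snr_all_def using assms by (intro Min_le) auto
  also have "\<dots> \<le> snr s t \<theta> \<theta>' i j"
    using assms by (intro Min_le) auto
  finally show ?thesis .
qed

theorem theorem2:
  fixes M :: "'w measure"
    and n m k kstar :: nat
    and \<theta> \<theta>' :: "nat \<Rightarrow> real ^ 'd"
    and \<sigma> \<sigma>' \<alpha> :: real
    and \<xi> \<xi>' X X' :: "nat \<Rightarrow> 'w \<Rightarrow> real ^ 'd"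
    and Sstar :: "nat set"
    and pistar :: "nat \<rightharpoonup> nat"
    and pihat :: "'w \<Rightarrow> nat \<rightharpoonup> nat"
  assumes "prob_space M"
    and "n \<ge> 2" and "m = n"
    and "\<sigma> \<ge> 0" and "\<sigma>' \<ge> 0" and "\<sigma>\<^sup>2 + \<sigma>'\<^sup>2 > 0"
    and "\<And>i. i \<in> {1..n} \<Longrightarrow> std_gaussian_vector M (\<xi> i)"
    and "\<And>j. j \<in> {1..m} \<Longrightarrow> std_gaussian_vector M (\<xi>' j)"
    and "prob_space.indep_vars M (\<lambda>_. borel) (case_sum \<xi> \<xi>') ({1..n} <+> {1..m})"
    and "\<And>i \<omega>. i \<in> {1..n} \<Longrightarrow> \<omega> \<in> space M \<Longrightarrow> X i \<omega> = \<theta> i + \<sigma> *\<^sub>R \<xi> i \<omega>"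
    and "\<And>j \<omega>. j \<in> {1..m} \<Longrightarrow> \<omega> \<in> space M \<Longrightarrow> X' j \<omega> = \<theta>' j + \<sigma>' *\<^sub>R \<xi>' j \<omega>"
    and "Sstar \<subseteq> {1..n}" and "card Sstar = kstar"
    and "dom pistar = Sstar" and "ran pistar \<subseteq> {1..m}" and "inj_on pistar Sstar"
    and "\<And>i. i \<in> Sstar \<Longrightarrow> \<theta> i = \<theta>' (the (pistar i))"
    and "0 < \<alpha>" and "\<alpha> < 1"
    and "k \<in> {1..n}" and "k \<le> kstar"
    and "snr_all n m \<sigma> \<sigma>' \<theta> \<theta>' pistar \<ge> snr_threshold n CARD('d) \<alpha>"
    and "pihat \<in> measurable M (count_space UNIV)"
    and "\<And>\<omega>. \<omega> \<in> space M \<Longrightarrow> is_LSS n m k (\<lambda>i. X i \<omega>) (\<lambda>j. X' j \<omega>) (pihat \<omega>)"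
  shows "measure M {\<omega> \<in> space M. dom (pihat \<omega>) \<subseteq> Sstar \<and>
           (\<forall>i \<in> dom (pihat \<omega>). pihat \<omega> i = pistar i)} \<ge> 1 - \<alpha>"
proof -
  interpret prob_space M by fact
  note gauss = assms(7,8) and indep = assms(9) and obs = assms(10,11)
  note LSS = assms(24)
  define d where "d = real CARD('d)"
  define L where "L = ln (4 * (real n)\<^sup>2 / \<alpha>)"
  define K where "K = (snr_threshold n CARD('d) \<alpha>)\<^sup>2"
  define v where "v = \<sigma>\<^sup>2 + \<sigma>'\<^sup>2"
  define D where "D i j \<omega> = (norm (X i \<omega> - X' j \<omega>))\<^sup>2 / v" for i j \<omega>
  have v: "v > 0"
    using assms by (simp add: v_def)
  have n: "real n \<ge> 2"
    using \<open>n \<ge> 2\<close> by simp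
  have "4 * (real n)\<^sup>2 / \<alpha> > 1"
  proof -
    have "(real n)\<^sup>2 \<ge> 2\<^sup>2"
      using n by (intro power_mono) auto
    then show ?thesis
      using \<open>0 < \<alpha>\<close> \<open>\<alpha> < 1\<close> by (simp add: field_simps)
  qed
  then have L: "L > 0" and exp_L: "exp (- L) = \<alpha> / (4 * (real n)\<^sup>2)"
    by (auto simp: L_def exp_minus)
  note thr = snr_threshold_bounds[OF L_def L, of "CARD('d)", folded K_def]
  \<comment> \<open>For each pair, only the deviation that would break the separation counts as bad.\<close>
  define Bad where "Bad = (\<lambda>(i, j). {\<omega> \<in> space M.
    if pistar i = Some j then d + K / 3 \<le> D i j \<omega> else D i j \<omega> \<le> d + K / 3})"
  let ?I = "{1..n} \<times> {1..m}"
  have D_eq: "D i j \<omega> = (norm ((\<theta> i - \<theta>' j) + \<sigma> *\<^sub>R \<xi> i \<omega> - \<sigma>' *\<^sub>R \<xi>' j \<omega>))\<^sup>2 / v"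
    if "i \<in> {1..n}" "j \<in> {1..m}" "\<omega> \<in> space M" for i j \<omega>
    using that by (simp add: D_def obs algebra_simps)
  have ind: "indep_var borel (\<xi> i) borel (\<xi>' j)" if "i \<in> {1..n}" "j \<in> {1..m}" for i j
    using indep_var_of_indep_vars[OF indep, of "Inl i" "Inr j"] that
    by (simp add: InlI InrI)
  have Bad: "Bad (i, j) \<in> events \<and> prob (Bad (i, j)) \<le> exp (- L)"
    if ij: "i \<in> {1..n}" "j \<in> {1..m}" for i j
  proof (cases "pistar i = Some j")
    case True
    then have mean: "\<theta> i - \<theta>' j = 0"
      using assms(17)[of i] \<open>dom pistar = Sstar\<close> by force
    have Bad_eq: "Bad (i, j) = {\<omega> \<in> space M.
        real CARD('d) + K / 3 \<le> (norm (\<sigma> *\<^sub>R \<xi> i \<omega> - \<sigma>' *\<^sub>R \<xi>' j \<omega>))\<^sup>2 / v}"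
      using True ij mean by (auto simp: Bad_def D_eq d_def)
    have [measurable]: "\<xi> i \<in> borel_measurable M" "\<xi>' j \<in> borel_measurable M"
      using ind[OF ij] by (simp_all add: indep_var_distribution_eq)
    show ?thesis
      unfolding Bad_eq
      using gaussian_diff_upper_tail[OF gauss(1)[OF ij(1)] gauss(2)[OF ij(2)] ind[OF ij] v_def v L thr(2,3)]
      by simp
  next
    case False
    have Bad_eq: "Bad (i, j) = {\<omega> \<in> space M.
        (norm ((\<theta> i - \<theta>' j) + \<sigma> *\<^sub>R \<xi> i \<omega> - \<sigma>' *\<^sub>R \<xi>' j \<omega>))\<^sup>2 / v \<le> real CARD('d) + K / 3}"
      using False ij by (auto simp: Bad_def D_eq d_def)
    have [measurable]: "\<xi> i \<in> borel_measurable M" "\<xi>' j \<in> borel_measurable M"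
      using ind[OF ij] by (simp_all add: indep_var_distribution_eq)
    have "snr_threshold n CARD('d) \<alpha> \<le> snr \<sigma> \<sigma>' \<theta> \<theta>' i j"
      using assms(22) snr_all_le_snr[of i n j m pistar \<sigma> \<sigma>' \<theta> \<theta>'] ij False by simp
    then have "K \<le> (snr \<sigma> \<sigma>' \<theta> \<theta>' i j)\<^sup>2"
      unfolding K_def using thr(1) by (intro power_mono)
    also have "\<dots> = (norm (\<theta> i - \<theta>' j))\<^sup>2 / v"
      using v by (simp add: snr_def v_def power_divide)
    finally have mean: "K \<le> (norm (\<theta> i - \<theta>' j))\<^sup>2 / v" .
    show ?thesis
      unfolding Bad_eq
      using gaussian_diff_lower_tail[OF gauss(1)[OF ij(1)] gauss(2)[OF ij(2)] ind[OF ij] v_def v L thr(2,3) mean]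
      by simp
  qed
  have Bad_events: "(\<Union>x\<in>?I. Bad x) \<in> events"
    using Bad by (intro sets.finite_UN) auto
  have "prob (\<Union>x\<in>?I. Bad x) \<le> (\<Sum>x\<in>?I. prob (Bad x))"
    using Bad by (intro measure_UNION_le) auto
  also have "\<dots> \<le> (\<Sum>x\<in>?I. exp (- L))"
    using Bad by (intro sum_mono) auto
  also have "\<dots> = (real n)\<^sup>2 * (\<alpha> / (4 * (real n)\<^sup>2))"
    using \<open>m = n\<close> by (simp add: exp_L power2_eq_square)
  also have "\<dots> \<le> \<alpha>"
    using n \<open>0 < \<alpha>\<close> by simp
  finally have prob_Bad: "prob (\<Union>x\<in>?I. Bad x) \<le> \<alpha>" .
  let ?G = "{\<omega> \<in> space M. dom (pihat \<omega>) \<subseteq> Sstar \<and>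
           (\<forall>i \<in> dom (pihat \<omega>). pihat \<omega> i = pistar i)}"
  have star: "pistar \<in> matching_maps n m kstar"
    using assms by (auto simp: matching_maps_def)
  have "space M - (\<Union>x\<in>?I. Bad x) \<subseteq> ?G"
  proof
    fix \<omega> assume \<omega>: "\<omega> \<in> space M - (\<Union>x\<in>?I. Bad x)"
    define c where "c i j = (norm (X i \<omega> - X' j \<omega>))\<^sup>2" for i j
    have c: "c i j = v * D i j \<omega>" for i j
      using v by (simp add: c_def D_def)
    have good: "if pistar i = Some j then D i j \<omega> < d + K / 3 else d + K / 3 < D i j \<omega>"
      if "i \<in> {1..n}" "j \<in> {1..m}" for i j
      using \<omega> that by (force simp: Bad_def not_le split: if_splits)
    have "pihat \<omega> \<subseteq>\<^sub>m pistar"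
    proof (rule separated_minimizer_is_submap[OF _ star \<open>k \<le> kstar\<close>])
      show "is_arg_min (\<lambda>q. \<Sum>i\<in>dom q. c i (the (q i))) (\<lambda>q. q \<in> matching_maps n m k) (pihat \<omega>)"
        using LSS[of \<omega>] \<omega> by (simp add: is_LSS_def c_def)
      show "c i j < v * (d + K / 3)" if "pistar i = Some j" for i j
      proof -
        have "i \<in> {1..n}" "j \<in> {1..m}"
          using that star by (auto simp: matching_maps_def ran_def)
        then show ?thesis
          using good[of i j] that v by (simp add: c)
      qed
      show "v * (d + K / 3) < c i j"
        if "i \<in> {1..n}" "j \<in> {1..m}" "pistar i \<noteq> Some j" for i j
        using good[of i j] that v by (simp add: c)
    qed
    then show "\<omega> \<in> ?G"
      using \<omega> map_le_implies_dom_le[of "pihat \<omega>" pistar] \<open>dom pistar = Sstar\<close>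
      by (auto simp: map_le_def)
  qed
  moreover have "?G \<in> events"
    using measurable_sets[OF assms(23), of "{p. dom p \<subseteq> Sstar \<and> (\<forall>i\<in>dom p. p i = pistar i)}"]
    by (simp add: vimage_def Int_def conj_commute conj_left_commute)
  ultimately have "prob (space M - (\<Union>x\<in>?I. Bad x)) \<le> prob ?G"
    by (intro finite_measure_mono)
  then show ?thesis
    using prob_Bad prob_compl[OF Bad_events] by simp
qed

end
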